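(* The rule ($\rho6$): from $(\phi\rightsquigarrow p)\wedge(p\rightsquigarrow\psi)\to\chi$ infer $(\phi\rightsquigarrow\psi)\to\chi$ (where $\phi,\psi,\chi$ are formulas and $p$ is a propositional variable not occurring in $\phi,\psi,\chi$) is admissible in $\mathsf{MS^2IC}$: whenever $(\phi\rightsquigarrow p)\wedge(p\rightsquigarrow\psi)\to\chi$ is a theorem of $\mathsf{MS^2IC}$ with $p$ not occurring in $\phi,\psi,\chi$, so is $(\phi\rightsquigarrow\psi)\to\chi$.
   Context: Language: propositional variables, $\top,\bot$, $\neg,\wedge,\vee,\to,\leftrightarrow$, a binary connective $\rightsquigarrow$ and a unary modality $\Box$; $\Diamond\phi:=\neg\Box\neg\phi$, $[\forall]\phi:=\top\rightsquigarrow\phi$. $\mathsf{MS^2IC}$: theorems are the least set containing all instances of classical tautologies and of (A1) $(\bot\rightsquigarrow\phi)\wedge(\phi\rightsquigarrow\top)$; (A2) $((\phi\vee\psi)\rightsquigarrow\chi)\leftrightarrow((\phi\rightsquigarrow\chi)\wedge(\psi\rightsquigarrow\chi))$; (A3) $(\phi\rightsquigarrow(\psi\wedge\chi))\leftrightarrow((\phi\rightsquigarrow\psi)\wedge(\phi\rightsquigarrow\chi))$; (A4) $(\phi\rightsquigarrow\psi)\to(\phi\to\psi)$; (A5) $(\phi\rightsquigarrow\psi)\leftrightarrow(\neg\psi\rightsquigarrow\neg\phi)$; (A8) $[\forall]\phi\to[\forall][\forall]\phi$; (A9) $\neg[\forall]\phi\to[\forall]\neg[\forall]\phi$; (A10)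 $(\phi\rightsquigarrow\psi)\leftrightarrow[\forall](\phi\rightsquigarrow\psi)$; (A11) $[\forall]\phi\to(\neg[\forall]\phi\rightsquigarrow\bot)$; (K) $\Box(\phi\to\psi)\to(\Box\phi\to\Box\psi)$; (Add) $(\phi\rightsquigarrow\psi)\to(\Box\phi\rightsquigarrow\Box\psi)$; closed under modus ponens, from $\phi$ infer $[\forall]\phi$, from $\phi$ infer $\Box\phi$. *)

theory Defs
  imports Main
begin

datatype fm =
    Var nat
  | Top  ("\<^bold>\<top>")
  | Bot  ("\<^bold>\<bottom>")
  | Neg fm  ("\<^bold>\<not> _" [80] 80)
  | Con fm fm  (infixr "\<^bold>\<and>" 75)
  | Dis fm fm  (infixr "\<^bold>\<or>" 70)
  | Imp fm fm  (infixr "\<^bold>\<longrightarrow>" 60)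
  | Iff fm fm  (infix "\<^bold>\<longleftrightarrow>" 55)
  | SImp fm fm  (infix "\<^bold>\<leadsto>" 65)
  | Box fm  ("\<^bold>\<box> _" [80] 80)

abbreviation Dia :: "fm \<Rightarrow> fm"  ("\<^bold>\<diamond> _" [80] 80)
  where "\<^bold>\<diamond> \<phi> \<equiv> \<^bold>\<not> \<^bold>\<box> \<^bold>\<not> \<phi>"

abbreviation Univ :: "fm \<Rightarrow> fm"  ("\<^bold>\<forall> _" [80] 80)
  where "\<^bold>\<forall> \<phi> \<equiv> \<^bold>\<top> \<^bold>\<leadsto> \<phi>"

primrec vars :: "fm \<Rightarrow> nat set" where
  "vars (Var q) = {q}"
| "vars \<^bold>\<top> = {}"
| "vars \<^bold>\<bottom> = {}"
| "vars (\<^bold>\<not> \<phi>) = vars \<phi>"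
| "vars (\<phi> \<^bold>\<and> \<psi>) = vars \<phi> \<union> vars \<psi>"
| "vars (\<phi> \<^bold>\<or> \<psi>) = vars \<phi> \<union> vars \<psi>"
| "vars (\<phi> \<^bold>\<longrightarrow> \<psi>) = vars \<phi> \<union> vars \<psi>"
| "vars (\<phi> \<^bold>\<longleftrightarrow> \<psi>) = vars \<phi> \<union> vars \<psi>"
| "vars (\<phi> \<^bold>\<leadsto> \<psi>) = vars \<phi> \<union> vars \<psi>"
| "vars (\<^bold>\<box> \<phi>) = vars \<phi>"

text \<open>Classical propositional formulas, i.e. those without \<open>\<leadsto>\<close> and \<open>\<box>\<close>. They occur only as
  schemes: an instance replaces every variable by an arbitrary formula of the full language.\<close>

datatype pfm =
    PVar nat
  | PTop
  | PBot
  | PNeg pfm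
  | PCon pfm pfm
  | PDis pfm pfm
  | PImp pfm pfm
  | PIff pfm pfm

primrec peval :: "(nat \<Rightarrow> bool) \<Rightarrow> pfm \<Rightarrow> bool" where
  "peval v (PVar q) = v q"
| "peval v PTop = True"
| "peval v PBot = False"
| "peval v (PNeg A) = (\<not> peval v A)"
| "peval v (PCon A B) = (peval v A \<and> peval v B)"
| "peval v (PDis A B) = (peval v A \<or> peval v B)"
| "peval v (PImp A B) = (peval v A \<longrightarrow> peval v B)"
| "peval v (PIff A B) = (peval v A \<longleftrightarrow> peval v B)"

definition tautology :: "pfm \<Rightarrow> bool"
  where "tautology A \<longleftrightarrow> (\<forall>v. peval v A)"

primrec inst :: "(nat \<Rightarrow> fm) \<Rightarrow> pfm \<Rightarrow> fm" where
  "inst \<sigma> (PVar q) = \<sigma> q"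
| "inst \<sigma> PTop = \<^bold>\<top>"
| "inst \<sigma> PBot = \<^bold>\<bottom>"
| "inst \<sigma> (PNeg A) = \<^bold>\<not> inst \<sigma> A"
| "inst \<sigma> (PCon A B) = inst \<sigma> A \<^bold>\<and> inst \<sigma> B"
| "inst \<sigma> (PDis A B) = inst \<sigma> A \<^bold>\<or> inst \<sigma> B"
| "inst \<sigma> (PImp A B) = inst \<sigma> A \<^bold>\<longrightarrow> inst \<sigma> B"
| "inst \<sigma> (PIff A B) = inst \<sigma> A \<^bold>\<longleftrightarrow> inst \<sigma> B"

inductive MS2IC :: "fm \<Rightarrow> bool"  ("\<turnstile> _" [50] 50) where
  Taut: "tautology A \<Longrightarrow> \<turnstile> inst \<sigma> A"
| A1: "\<turnstile> (\<^bold>\<bottom> \<^bold>\<leadsto> \<phi>) \<^bold>\<and> (\<phi> \<^bold>\<leadsto> \<^bold>\<top>)"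
| A2: "\<turnstile> ((\<phi> \<^bold>\<or> \<psi>) \<^bold>\<leadsto> \<chi>) \<^bold>\<longleftrightarrow> ((\<phi> \<^bold>\<leadsto> \<chi>) \<^bold>\<and> (\<psi> \<^bold>\<leadsto> \<chi>))"
| A3: "\<turnstile> (\<phi> \<^bold>\<leadsto> (\<psi> \<^bold>\<and> \<chi>)) \<^bold>\<longleftrightarrow> ((\<phi> \<^bold>\<leadsto> \<psi>) \<^bold>\<and> (\<phi> \<^bold>\<leadsto> \<chi>))"
| A4: "\<turnstile> (\<phi> \<^bold>\<leadsto> \<psi>) \<^bold>\<longrightarrow> (\<phi> \<^bold>\<longrightarrow> \<psi>)"
| A5: "\<turnstile> (\<phi> \<^bold>\<leadsto> \<psi>) \<^bold>\<longleftrightarrow> ((\<^bold>\<not> \<psi>) \<^bold>\<leadsto> (\<^bold>\<not> \<phi>))"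
| A8: "\<turnstile> (\<^bold>\<forall> \<phi>) \<^bold>\<longrightarrow> (\<^bold>\<forall> (\<^bold>\<forall> \<phi>))"
| A9: "\<turnstile> (\<^bold>\<not> (\<^bold>\<forall> \<phi>)) \<^bold>\<longrightarrow> (\<^bold>\<forall> (\<^bold>\<not> (\<^bold>\<forall> \<phi>)))"
| A10: "\<turnstile> (\<phi> \<^bold>\<leadsto> \<psi>) \<^bold>\<longleftrightarrow> (\<^bold>\<forall> (\<phi> \<^bold>\<leadsto> \<psi>))"
| A11: "\<turnstile> (\<^bold>\<forall> \<phi>) \<^bold>\<longrightarrow> ((\<^bold>\<not> (\<^bold>\<forall> \<phi>)) \<^bold>\<leadsto> \<^bold>\<bottom>)"
| K: "\<turnstile> (\<^bold>\<box> (\<phi> \<^bold>\<longrightarrow> \<psi>)) \<^bold>\<longrightarrow> ((\<^bold>\<box> \<phi>) \<^bold>\<longrightarrow> (\<^bold>\<box> \<psi>))"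
| Add: "\<turnstile> (\<phi> \<^bold>\<leadsto> \<psi>) \<^bold>\<longrightarrow> ((\<^bold>\<box> \<phi>) \<^bold>\<leadsto> (\<^bold>\<box> \<psi>))"
| MP: "\<turnstile> \<phi> \<^bold>\<longrightarrow> \<psi> \<Longrightarrow> \<turnstile> \<phi> \<Longrightarrow> \<turnstile> \<psi>"
| NecAll: "\<turnstile> \<phi> \<Longrightarrow> \<turnstile> \<^bold>\<forall> \<phi>"
| NecBox: "\<turnstile> \<phi> \<Longrightarrow> \<turnstile> \<^bold>\<box> \<phi>"

end

theory Submission
  imports Defs "HOL-Library.Countable"
begin

text \<open>
  The calculus has no replacement of equivalents under \<open>\<leadsto>\<close> (and \<open>[\<forall>]\<close> is not even a normal
  modality), so \<open>\<leadsto>\<close> may be interpreted with a purely syntactic side condition. Suppose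
  \<open>\<phi> \<leadsto> \<psi>\<close> belongs to a maximal consistent set \<open>\<Gamma>\<close> that omits \<open>\<chi>\<close>. Take the
  canonical Kripke model for \<open>\<box>\<close> on all maximal consistent sets having the same \<open>\<leadsto>\<close>-formulas as
  \<open>\<Gamma>\<close>, but let \<open>p\<close> be true exactly where \<open>\<phi>\<close> is. Call \<open>\<alpha> \<leadsto> \<beta>\<close> true if \<open>\<alpha>\<close> implies
  \<open>\<beta>\<close> at every world and \<open>\<Gamma>\<close> contains \<open>\<alpha>\<^sup>- \<leadsto> \<beta>\<^sup>+\<close>, where \<open>\<alpha>\<^sup>-\<close> and \<open>\<beta>\<^sup>+\<close> are
  \<open>p\<close>-free formulas approximating \<open>\<alpha>\<close> from below and \<open>\<beta>\<close> from above. All theorems are true in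
  this model, \<open>p\<close>-free formulas keep their truth values, and both \<open>\<phi> \<leadsto> p\<close> and
  \<open>p \<leadsto> \<psi>\<close> become true because \<open>p\<^sup>+ = \<top>\<close> and \<open>p\<^sup>- = \<bottom>\<close>; hence the premise of the rule
  fails at \<open>\<Gamma>\<close>.
\<close>

section \<open>Propositional reasoning\<close>

instance fm :: countable
  by countable_datatype

text \<open>Formulas headed by \<leadsto> or \<box> become atoms, numbered by their own codes so
  that \<open>from_nat\<close> restores them.\<close>

primrec skeleton :: "fm \<Rightarrow> pfm" where
  "skeleton (Var q) = PVar (to_nat (Var q))"
| "skeleton \<^bold>\<top> = PTop"
| "skeleton \<^bold>\<bottom> = PBot"
| "skeleton (\<^bold>\<not> a) = PNeg (skeleton a)"
| "skeleton (a \<^bold>\<and> b) = PCon (skeleton a) (skeleton b)"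
| "skeleton (a \<^bold>\<or> b) = PDis (skeleton a) (skeleton b)"
| "skeleton (a \<^bold>\<longrightarrow> b) = PImp (skeleton a) (skeleton b)"
| "skeleton (a \<^bold>\<longleftrightarrow> b) = PIff (skeleton a) (skeleton b)"
| "skeleton (a \<^bold>\<leadsto> b) = PVar (to_nat (a \<^bold>\<leadsto> b))"
| "skeleton (\<^bold>\<box> a) = PVar (to_nat (\<^bold>\<box> a))"

lemma inst_skeleton: "inst from_nat (skeleton a) = a"
  by (induction a) simp_all

lemma MS2IC_tautI:
  assumes "\<And>v. peval v (skeleton a)"
  shows "\<turnstile> a"
  using Taut[of "skeleton a" from_nat] assms by (simp add: tautology_def inst_skeleton)

section \<open>Maximal consistent sets\<close>

text \<open>Closure under necessitation is not demanded, so that adjoining a formula, as in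
  \<open>mp_theory_extend\<close>, stays within this class.\<close>

definition mp_theory :: "fm set \<Rightarrow> bool" where
  "mp_theory T \<longleftrightarrow> (\<forall>a. \<turnstile> a \<longrightarrow> a \<in> T) \<and> (\<forall>a b. a \<^bold>\<longrightarrow> b \<in> T \<longrightarrow> a \<in> T \<longrightarrow> b \<in> T)"

lemma mp_theory_thm: "mp_theory T \<Longrightarrow> \<turnstile> a \<Longrightarrow> a \<in> T"
  by (simp add: mp_theory_def)

lemma mp_theory_mp: "mp_theory T \<Longrightarrow> a \<^bold>\<longrightarrow> b \<in> T \<Longrightarrow> a \<in> T \<Longrightarrow> b \<in> T"
  unfolding mp_theory_def by blast

lemma mp_theory_taut1:
  assumes "mp_theory T" "a \<in> T"
    and "\<And>v. peval v (skeleton a) \<Longrightarrow> peval v (skeleton b)"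
  shows "b \<in> T"
proof -
  have "\<turnstile> a \<^bold>\<longrightarrow> b"
    by (rule MS2IC_tautI) (simp add: assms(3))
  then show ?thesis
    using assms(1,2) mp_theory_thm[of T "a \<^bold>\<longrightarrow> b"] mp_theory_mp[of T a b] by blast
qed

lemma mp_theory_taut2:
  assumes "mp_theory T" "a \<in> T" "b \<in> T"
    and "\<And>v. peval v (skeleton a) \<Longrightarrow> peval v (skeleton b) \<Longrightarrow> peval v (skeleton c)"
  shows "c \<in> T"
proof -
  have "b \<^bold>\<longrightarrow> c \<in> T"
    by (rule mp_theory_taut1[OF assms(1,2)]) (simp add: assms(4))
  then show ?thesis
    using assms(1,3) mp_theory_mp[of T b c] by blast
qed

text \<open>Deduction theorem: this set is the least \<open>mp_theory\<close> containing
  \<open>T\<close> and \<open>a\<close>.\<close>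

lemma mp_theory_extend:
  assumes "mp_theory T"
  shows "mp_theory {b. a \<^bold>\<longrightarrow> b \<in> T}"
  unfolding mp_theory_def
proof (intro conjI allI impI; unfold mem_Collect_eq)
  fix b assume "\<turnstile> b"
  then have "b \<in> T"
    using assms mp_theory_thm by blast
  then show "a \<^bold>\<longrightarrow> b \<in> T"
    by (rule mp_theory_taut1[OF assms]) simp
next
  fix b c assume "a \<^bold>\<longrightarrow> b \<^bold>\<longrightarrow> c \<in> T" "a \<^bold>\<longrightarrow> b \<in> T"
  then show "a \<^bold>\<longrightarrow> c \<in> T"
    by (rule mp_theory_taut2[OF assms]) simp
qed

definition mcs :: "fm set \<Rightarrow> bool" where
  "mcs w \<longleftrightarrow> mp_theory w \<and> (\<forall>a. \<^bold>\<not> a \<in> w \<longleftrightarrow> a \<notin> w)"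

lemma mcs_mp_theory: "mcs w \<Longrightarrow> mp_theory w"
  by (simp add: mcs_def)

lemma Lindenbaum:
  assumes "mp_theory T" "c \<notin> T"
  obtains w where "mcs w" "T \<subseteq> w" "c \<notin> w"
proof -
  let ?A = "{U. mp_theory U \<and> T \<subseteq> U \<and> c \<notin> U}"
  have union: "\<Union>C \<in> ?A" if "C \<noteq> {}" "subset.chain ?A C" for C
  proof -
    have C: "\<forall>U\<in>C. mp_theory U \<and> T \<subseteq> U \<and> c \<notin> U"
      and lin: "\<forall>U\<in>C. \<forall>V\<in>C. U \<subseteq> V \<or> V \<subseteq> U"
      using that(2) by (auto simp: subset_chain_def)
    have "\<forall>a b. a \<^bold>\<longrightarrow> b \<in> \<Union>C \<longrightarrow> a \<in> \<Union>C \<longrightarrow> b \<in> \<Union>C"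
    proof (intro allI impI)
      fix a b assume ab: "a \<^bold>\<longrightarrow> b \<in> \<Union>C" "a \<in> \<Union>C"
      obtain U V where "U \<in> C" "V \<in> C" "a \<^bold>\<longrightarrow> b \<in> U" "a \<in> V"
        using ab by blast
      then obtain X where "X \<in> C" "a \<^bold>\<longrightarrow> b \<in> X" "a \<in> X"
        using lin by blast
      then show "b \<in> \<Union>C"
        using C mp_theory_mp[of X a b] by blast
    qed
    moreover have "\<forall>a. \<turnstile> a \<longrightarrow> a \<in> \<Union>C"
      using C \<open>C \<noteq> {}\<close> mp_theory_thm by blast
    ultimately have "mp_theory (\<Union>C)"
      unfolding mp_theory_def by (intro conjI)
    then show ?thesis
      using C \<open>C \<noteq> {}\<close> by blast
  qed
  have "?A \<noteq> {}"
    using assms by auto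
  then have "\<exists>w\<in>?A. \<forall>U\<in>?A. w \<subseteq> U \<longrightarrow> U = w"
    using union by (rule subset_Zorn_nonempty)
  then obtain w where w: "w \<in> ?A" and max: "\<forall>U\<in>?A. w \<subseteq> U \<longrightarrow> U = w"
    by (rule bexE)
  from w have th: "mp_theory w" and "T \<subseteq> w" and c: "c \<notin> w"
    by simp_all
  \<comment> \<open>If \<open>a \<longrightarrow> c\<close> is not in \<open>w\<close>, the theory
    generated by \<open>w\<close> and \<open>a\<close> still omits \<open>c\<close>; by maximality
    it equals \<open>w\<close>, which then contains \<open>a\<close>.\<close>
  have dec: "a \<in> w \<or> a \<^bold>\<longrightarrow> c \<in> w" for a
  proof (rule ccontr)
    assume neg: "\<not> ?thesis"
    let ?U = "{b. a \<^bold>\<longrightarrow> b \<in> w}"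
    have sub: "w \<subseteq> ?U"
    proof
      fix b assume "b \<in> w"
      then have "a \<^bold>\<longrightarrow> b \<in> w"
        by (rule mp_theory_taut1[OF th]) simp
      then show "b \<in> ?U" by simp
    qed
    have "?U \<in> ?A"
      using neg subset_trans[OF \<open>T \<subseteq> w\<close> sub] mp_theory_extend[OF th] by simp
    from bspec[OF max this] sub have eq: "?U = w"
      by (rule mp)
    have "a \<^bold>\<longrightarrow> a \<in> w"
      by (rule mp_theory_thm[OF th]) (rule MS2IC_tautI, simp)
    then have "a \<in> ?U"
      by (rule CollectI)
    then show False
      unfolding eq using neg by simp
  qed
  have "\<^bold>\<not> a \<in> w \<longleftrightarrow> a \<notin> w" for a
  proof
    assume na: "\<^bold>\<not> a \<in> w"
    show "a \<notin> w"
    proof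
      assume "a \<in> w"
      then have "c \<in> w"
        using na by (rule mp_theory_taut2[OF th]) simp
      then show False using c by simp
    qed
  next
    assume "a \<notin> w"
    then have ac: "a \<^bold>\<longrightarrow> c \<in> w"
      using dec[of a] by blast
    show "\<^bold>\<not> a \<in> w"
    proof (rule ccontr)
      assume "\<^bold>\<not> a \<notin> w"
      then have "\<^bold>\<not> a \<^bold>\<longrightarrow> c \<in> w"
        using dec[of "\<^bold>\<not> a"] by blast
      with ac have "c \<in> w"
        by (rule mp_theory_taut2[OF th]) auto
      then show False using c by simp
    qed
  qed
  then have "mcs w"
    using th by (simp add: mcs_def)
  then show ?thesis
    using c \<open>T \<subseteq> w\<close> that by blast
qed

context
  fixes w assumes w: "mcs w"
begin

lemma mcs_thm: "\<turnstile> a \<Longrightarrow> a \<in> w"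
  using w mp_theory_thm mcs_mp_theory by blast

lemma mcs_Neg: "\<^bold>\<not> a \<in> w \<longleftrightarrow> a \<notin> w"
  using w by (simp add: mcs_def)

lemma mcs_Top: "\<^bold>\<top> \<in> w"
  by (rule mcs_thm, rule MS2IC_tautI) simp

lemma mcs_Bot: "\<^bold>\<bottom> \<notin> w"
proof -
  have "\<^bold>\<not> \<^bold>\<bottom> \<in> w"
    by (rule mcs_thm, rule MS2IC_tautI) simp
  then show ?thesis by (simp add: mcs_Neg)
qed

lemma mcs_Imp: "a \<^bold>\<longrightarrow> b \<in> w \<longleftrightarrow> (a \<in> w \<longrightarrow> b \<in> w)"
proof
  show "a \<in> w \<longrightarrow> b \<in> w" if "a \<^bold>\<longrightarrow> b \<in> w"
    using mp_theory_mp[OF mcs_mp_theory[OF w] that] by blast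
next
  assume "a \<in> w \<longrightarrow> b \<in> w"
  then consider "\<^bold>\<not> a \<in> w" | "b \<in> w"
    using mcs_Neg[of a] by blast
  then show "a \<^bold>\<longrightarrow> b \<in> w"
    by cases (erule mp_theory_taut1[OF mcs_mp_theory[OF w]], simp)+
qed

lemma mcs_Con: "a \<^bold>\<and> b \<in> w \<longleftrightarrow> a \<in> w \<and> b \<in> w"
proof -
  have "\<turnstile> a \<^bold>\<and> b \<^bold>\<longrightarrow> a" "\<turnstile> a \<^bold>\<and> b \<^bold>\<longrightarrow> b" "\<turnstile> a \<^bold>\<longrightarrow> b \<^bold>\<longrightarrow> a \<^bold>\<and> b"
    by (rule MS2IC_tautI, simp)+
  from this[THEN mcs_thm] show ?thesis
    by (auto simp: mcs_Imp)
qed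

lemma mcs_Dis: "a \<^bold>\<or> b \<in> w \<longleftrightarrow> a \<in> w \<or> b \<in> w"
proof -
  have "\<turnstile> a \<^bold>\<longrightarrow> a \<^bold>\<or> b" "\<turnstile> b \<^bold>\<longrightarrow> a \<^bold>\<or> b" "\<turnstile> a \<^bold>\<or> b \<^bold>\<longrightarrow> \<^bold>\<not> a \<^bold>\<longrightarrow> b"
    by (rule MS2IC_tautI, auto)+
  from this[THEN mcs_thm] show ?thesis
    by (auto simp: mcs_Imp mcs_Neg)
qed

lemma mcs_Iff: "(a \<^bold>\<longleftrightarrow> b) \<in> w \<longleftrightarrow> (a \<in> w \<longleftrightarrow> b \<in> w)"
proof -
  have "\<turnstile> (a \<^bold>\<longleftrightarrow> b) \<^bold>\<longrightarrow> a \<^bold>\<longrightarrow> b" "\<turnstile> (a \<^bold>\<longleftrightarrow> b) \<^bold>\<longrightarrow> b \<^bold>\<longrightarrow> a"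
    "\<turnstile> (a \<^bold>\<longrightarrow> b) \<^bold>\<longrightarrow> (b \<^bold>\<longrightarrow> a) \<^bold>\<longrightarrow> (a \<^bold>\<longleftrightarrow> b)"
    by (rule MS2IC_tautI, auto)+
  from this[THEN mcs_thm] show ?thesis
    by (auto simp: mcs_Imp)
qed

lemmas mcs_simps = mcs_Neg mcs_Top mcs_Bot mcs_Imp mcs_Con mcs_Dis mcs_Iff

lemmas mcs_axioms =
  A1[THEN mcs_thm, unfolded mcs_simps] A2[THEN mcs_thm, unfolded mcs_simps]
  A3[THEN mcs_thm, unfolded mcs_simps] A5[THEN mcs_thm, unfolded mcs_simps]

lemma mcs_A4: "a \<^bold>\<leadsto> b \<in> w \<Longrightarrow> a \<in> w \<Longrightarrow> b \<in> w"
  using mcs_thm[OF A4] by (auto simp: mcs_Imp)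

lemma mcs_A9: "\<^bold>\<forall> a \<notin> w \<Longrightarrow> \<^bold>\<forall> (\<^bold>\<not> \<^bold>\<forall> a) \<in> w"
  using mcs_thm[OF A9] by (auto simp: mcs_Imp mcs_Neg)

lemma mcs_A10: "\<^bold>\<forall> (a \<^bold>\<leadsto> b) \<in> w \<longleftrightarrow> a \<^bold>\<leadsto> b \<in> w"
  using mcs_thm[OF A10] by (auto simp: mcs_Iff)

lemma mcs_Add: "a \<^bold>\<leadsto> b \<in> w \<Longrightarrow> \<^bold>\<box> a \<^bold>\<leadsto> \<^bold>\<box> b \<in> w"
  using mcs_thm[OF Add] by (auto simp: mcs_Imp)

text \<open>(Add) turns \<open>\<top> \<leadsto> a\<close> into
  \<open>\<box> \<top> \<leadsto> \<box> a\<close>; (A4) and the theorem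
  \<open>\<box> \<top>\<close> finish.\<close>

lemma mcs_Box_if_Univ:
  assumes "\<^bold>\<forall> a \<in> w"
  shows "\<^bold>\<box> a \<in> w"
proof -
  have "\<turnstile> \<^bold>\<box> \<^bold>\<top>"
    by (rule NecBox, rule MS2IC_tautI) simp
  then show ?thesis
    using mcs_A4[OF mcs_Add[OF assms]] mcs_thm by simp
qed

lemma mp_theory_unbox: "mp_theory {a. \<^bold>\<box> a \<in> w}"
  unfolding mp_theory_def
proof (intro conjI allI impI; unfold mem_Collect_eq)
  show "\<^bold>\<box> a \<in> w" if "\<turnstile> a" for a
    using that NecBox mcs_thm by blast
  show "\<^bold>\<box> b \<in> w" if "\<^bold>\<box> (a \<^bold>\<longrightarrow> b) \<in> w" "\<^bold>\<box> a \<in> w" for a b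
    using that mcs_thm[OF K] by (auto simp: mcs_Imp)
qed

end

section \<open>Approximation by formulas without a given variable\<close>

text \<open>The flag selects the upper approximation. The upper bound of a \<open>\<leadsto>\<close>-formula is
  \<open>[\<forall>]\<top>\<close> rather than \<open>\<top>\<close> because (A11) yields \<open>\<not>[\<forall>]\<top> \<leadsto> \<bottom>\<close>, whereas
  \<open>\<not>\<top> \<leadsto> \<bottom>\<close> does not follow from the axioms.\<close>

primrec approx :: "nat \<Rightarrow> bool \<Rightarrow> fm \<Rightarrow> fm" where
  "approx p s (Var q) = (if q \<noteq> p then Var q else if s then \<^bold>\<top> else \<^bold>\<bottom>)"
| "approx p s \<^bold>\<top> = \<^bold>\<top>"
| "approx p s \<^bold>\<bottom> = \<^bold>\<bottom>"
| "approx p s (\<^bold>\<not> a) = \<^bold>\<not> approx p (\<not> s) a"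
| "approx p s (a \<^bold>\<and> b) = approx p s a \<^bold>\<and> approx p s b"
| "approx p s (a \<^bold>\<or> b) = approx p s a \<^bold>\<or> approx p s b"
| "approx p s (a \<^bold>\<longrightarrow> b) = approx p (\<not> s) a \<^bold>\<longrightarrow> approx p s b"
| "approx p s (a \<^bold>\<longleftrightarrow> b) =
    (if p \<notin> vars a \<union> vars b then a \<^bold>\<longleftrightarrow> b else if s then \<^bold>\<top> else \<^bold>\<bottom>)"
| "approx p s (a \<^bold>\<leadsto> b) =
    (if p \<notin> vars a \<union> vars b then a \<^bold>\<leadsto> b else if s then \<^bold>\<forall> \<^bold>\<top> else \<^bold>\<bottom>)"
| "approx p s (\<^bold>\<box> a) = (if p \<notin> vars a then \<^bold>\<box> a else if s then \<^bold>\<top> else \<^bold>\<bottom>)"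

abbreviation "lower p \<equiv> approx p False"
abbreviation "upper p \<equiv> approx p True"

lemma approx_id: "p \<notin> vars a \<Longrightarrow> approx p s a = a"
  by (induction a arbitrary: s) simp_all

lemma MS2IC_Univ_Top: "\<turnstile> \<^bold>\<forall> \<^bold>\<top>"
  by (rule NecAll, rule MS2IC_tautI) simp

text \<open>Both bounds share one induction because negation exchanges them. The theorem
  [\<forall>]\<top> covers the upper bound of a \<leadsto>-formula.\<close>

lemma mcs_approx:
  assumes w: "mcs w"
  shows "(lower p a \<in> w \<longrightarrow> a \<in> w) \<and> (a \<in> w \<longrightarrow> upper p a \<in> w)"
  using mcs_thm[OF w MS2IC_Univ_Top]
  by (induction a) (auto simp: mcs_simps[OF w])

lemma MS2IC_iff_mcs: "\<turnstile> a \<longleftrightarrow> (\<forall>w. mcs w \<longrightarrow> a \<in> w)"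
proof
  assume "\<forall>w. mcs w \<longrightarrow> a \<in> w"
  moreover have "mp_theory {b. \<turnstile> b}"
    using MP by (auto simp: mp_theory_def)
  ultimately show "\<turnstile> a"
    using Lindenbaum[of "{b. \<turnstile> b}" a] by blast
qed (use mcs_thm in blast)

lemma MS2IC_upper: "\<turnstile> a \<Longrightarrow> \<turnstile> upper p a"
  using mcs_approx by (auto simp: MS2IC_iff_mcs)

section \<open>The model\<close>

definition worlds :: "fm set \<Rightarrow> fm set set" where
  "worlds \<Gamma> = {w. mcs w \<and> (\<forall>a b. a \<^bold>\<leadsto> b \<in> w \<longleftrightarrow> a \<^bold>\<leadsto> b \<in> \<Gamma>)}"

definition acc :: "fm set \<Rightarrow> fm set \<Rightarrow> bool" where
  "acc w u \<longleftrightarrow> (\<forall>a. \<^bold>\<box> a \<in> w \<longrightarrow> a \<in> u)"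

text \<open>Since [\<forall>] implies \<box>, a \<leadsto>-formula passes to successors by (A10),
  and its negation by (A9) together with (A10).\<close>

lemma acc_worlds:
  assumes "w \<in> worlds \<Gamma>" "mcs u" "acc w u"
  shows "u \<in> worlds \<Gamma>"
proof -
  have w: "mcs w"
    using assms(1) by (simp add: worlds_def)
  have step: "a \<in> u" if "\<^bold>\<forall> a \<in> w" for a
    using that assms(3) mcs_Box_if_Univ[OF w] by (auto simp: acc_def)
  have "a \<^bold>\<leadsto> b \<in> u \<longleftrightarrow> a \<^bold>\<leadsto> b \<in> w" for a b
  proof
    show "a \<^bold>\<leadsto> b \<in> u" if "a \<^bold>\<leadsto> b \<in> w"
      using that step[of "a \<^bold>\<leadsto> b"] by (simp add: mcs_A10[OF w])
    show "a \<^bold>\<leadsto> b \<in> w" if "a \<^bold>\<leadsto> b \<in> u"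
    proof (rule ccontr)
      assume "a \<^bold>\<leadsto> b \<notin> w"
      then have "\<^bold>\<not> \<^bold>\<forall> (a \<^bold>\<leadsto> b) \<in> u"
        using step[OF mcs_A9[OF w]] by (simp add: mcs_A10[OF w])
      then show False
        using that by (simp add: mcs_A10[OF assms(2)] mcs_Neg[OF assms(2)])
    qed
  qed
  then show ?thesis
    using assms(1,2) by (simp add: worlds_def)
qed

text \<open>Lindenbaum applied to the formulas boxed in \<open>w\<close> gives a successor omitting
  \<open>a\<close>; \<open>acc_worlds\<close> keeps it in the model.\<close>

lemma mcs_Box_iff:
  assumes "w \<in> worlds \<Gamma>"
  shows "\<^bold>\<box> a \<in> w \<longleftrightarrow> (\<forall>u\<in>worlds \<Gamma>. acc w u \<longrightarrow> a \<in> u)"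
proof
  assume R: "\<forall>u\<in>worlds \<Gamma>. acc w u \<longrightarrow> a \<in> u"
  have w: "mcs w"
    using assms by (simp add: worlds_def)
  show "\<^bold>\<box> a \<in> w"
  proof (rule ccontr)
    assume "\<^bold>\<box> a \<notin> w"
    then obtain u where "mcs u" "{b. \<^bold>\<box> b \<in> w} \<subseteq> u" "a \<notin> u"
      using Lindenbaum[OF mp_theory_unbox[OF w], of a] by blast
    moreover from this have "acc w u"
      by (auto simp: acc_def)
    ultimately show False
      using R acc_worlds[OF assms] by blast
  qed
qed (auto simp: acc_def)

text \<open>The side condition is read in \<open>\<Gamma>\<close> rather than \<open>w\<close>, so
  the truth of a \<leadsto>-formula is the same at every world.\<close>

primrec sat :: "fm set \<Rightarrow> nat \<Rightarrow> fm \<Rightarrow> fm set \<Rightarrow> fm \<Rightarrow> bool" where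
  "sat \<Gamma> p \<phi> w (Var q) \<longleftrightarrow> (if q = p then \<phi> else Var q) \<in> w"
| "sat \<Gamma> p \<phi> w \<^bold>\<top> \<longleftrightarrow> True"
| "sat \<Gamma> p \<phi> w \<^bold>\<bottom> \<longleftrightarrow> False"
| "sat \<Gamma> p \<phi> w (\<^bold>\<not> a) \<longleftrightarrow> \<not> sat \<Gamma> p \<phi> w a"
| "sat \<Gamma> p \<phi> w (a \<^bold>\<and> b) \<longleftrightarrow> sat \<Gamma> p \<phi> w a \<and> sat \<Gamma> p \<phi> w b"
| "sat \<Gamma> p \<phi> w (a \<^bold>\<or> b) \<longleftrightarrow> sat \<Gamma> p \<phi> w a \<or> sat \<Gamma> p \<phi> w b"
| "sat \<Gamma> p \<phi> w (a \<^bold>\<longrightarrow> b) \<longleftrightarrow> (sat \<Gamma> p \<phi> w a \<longrightarrow> sat \<Gamma> p \<phi> w b)"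
| "sat \<Gamma> p \<phi> w (a \<^bold>\<longleftrightarrow> b) \<longleftrightarrow> (sat \<Gamma> p \<phi> w a \<longleftrightarrow> sat \<Gamma> p \<phi> w b)"
| "sat \<Gamma> p \<phi> w (a \<^bold>\<leadsto> b) \<longleftrightarrow>
    (\<forall>u\<in>worlds \<Gamma>. sat \<Gamma> p \<phi> u a \<longrightarrow> sat \<Gamma> p \<phi> u b) \<and> lower p a \<^bold>\<leadsto> upper p b \<in> \<Gamma>"
| "sat \<Gamma> p \<phi> w (\<^bold>\<box> a) \<longleftrightarrow> (\<forall>u\<in>worlds \<Gamma>. acc w u \<longrightarrow> sat \<Gamma> p \<phi> u a)"

lemma sat_inst: "sat \<Gamma> p \<phi> w (inst \<sigma> A) \<longleftrightarrow> peval (\<lambda>q. sat \<Gamma> p \<phi> w (\<sigma> q)) A"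
  by (induction A) simp_all

text \<open>Without \<open>p\<close> both bounds are the formula itself, so the side condition is
  membership in \<open>\<Gamma>\<close>, and (A4) at each world yields the clause about
  worlds.\<close>

lemma sat_iff_mem:
  assumes "p \<notin> vars a" "w \<in> worlds \<Gamma>"
  shows "sat \<Gamma> p \<phi> w a \<longleftrightarrow> a \<in> w"
  using assms
proof (induction a arbitrary: w)
  case (SImp a b)
  have "\<forall>u\<in>worlds \<Gamma>. a \<in> u \<longrightarrow> b \<in> u" if "a \<^bold>\<leadsto> b \<in> \<Gamma>"
    using that mcs_A4 by (auto simp: worlds_def)
  then show ?case
    using SImp by (auto simp: approx_id worlds_def)
next
  case (Box a)
  then show ?case
    by (simp add: mcs_Box_iff)
qed (simp_all add: worlds_def mcs_simps)

text \<open>The bounds commute with \<and> and \<or> and swap under \<not>, so the side conditions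
  of (A2), (A3), (A5) are instances of the same axioms in \<open>\<Gamma>\<close>.\<close>

theorem MS2IC_sat:
  assumes \<Gamma>: "mcs \<Gamma>"
  shows "\<turnstile> a \<Longrightarrow> w \<in> worlds \<Gamma> \<Longrightarrow> sat \<Gamma> p \<phi> w a"
proof (induction a arbitrary: w rule: MS2IC.induct)
  note ax = mcs_axioms[OF \<Gamma>] and mem = mcs_thm[OF \<Gamma>]
  \<comment> \<open>These are the side conditions that arise when \<open>p\<close> occurs under a
    \<leadsto>, where the bounds are [\<forall>]\<top> and \<bottom>.\<close>
  have top: "\<^bold>\<forall> (\<^bold>\<forall> \<^bold>\<top>) \<in> \<Gamma>" "\<^bold>\<forall> (\<^bold>\<not> \<^bold>\<bottom>) \<in> \<Gamma>" "\<^bold>\<forall> \<^bold>\<top> \<in> \<Gamma>"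
    using NecAll[OF MS2IC_Univ_Top] MS2IC_Univ_Top NecAll[OF MS2IC_tautI[of "\<^bold>\<not> \<^bold>\<bottom>"]] mem by auto
  {
    case (Taut A \<sigma>)
    then show ?case by (simp add: sat_inst tautology_def)
  next
    case (A1 a)
    then show ?case using ax by simp
  next
    case (A2 a b c)
    then show ?case using ax by auto
  next
    case (A3 a b c)
    then show ?case using ax by auto
  next
    case (A4 a b)
    then show ?case by auto
  next
    case (A5 a b)
    then show ?case using ax by auto
  next
    case (A8 a)
    then show ?case using top mcs_A10[OF \<Gamma>] by (auto simp: approx_id)
  next
    case (A9 a)
    show ?case
    \<comment> \<open>If \<open>p\<close> occurs, the side condition is [\<forall>]\<not>\<bottom>;
      otherwise the whole axiom is free of \<open>p\<close> and truth is membership.\<close>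
    proof (cases "p \<in> vars a")
      case True
      then show ?thesis using top by auto
    next
      case False
      moreover have "mcs w"
        using A9 by (simp add: worlds_def)
      ultimately show ?thesis
        using A9 mcs_thm[OF _ MS2IC.A9] by (subst sat_iff_mem) simp_all
    qed
  next
    case (A10 a b)
    then show ?case using top mcs_A10[OF \<Gamma>] by (auto simp: approx_id)
  next
    case (A11 a)
    have "\<^bold>\<not> \<^bold>\<forall> b \<^bold>\<leadsto> \<^bold>\<bottom> \<in> \<Gamma>" if "\<^bold>\<forall> b \<in> \<Gamma>" for b
      using that mem[OF MS2IC.A11] by (auto simp: mcs_Imp[OF \<Gamma>])
    then show ?case using top A11 by (auto simp: approx_id)
  next
    case (K a b)
    then show ?case by simp
  next
    case (Add a b)
    \<comment> \<open>If \<open>p\<close> occurs in \<open>a\<close> or \<open>b\<close>, the left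
      bound is \<bottom> or the right one \<top>, and (A1) applies.\<close>
    then show ?case using ax mcs_Add[OF \<Gamma>] by (auto simp: approx_id)
  next
    case (MP a b)
    then show ?case by simp
  next
    case (NecAll a)
    then show ?case
      \<comment> \<open>Truth at all worlds does not give the side condition; provability of the
        upper bound does.\<close>
      using mem[OF MS2IC.NecAll[OF MS2IC_upper]] by simp
  next
    case (NecBox a)
    then show ?case by simp
  }
qed

theorem theorem4p11:
  fixes \<phi> \<psi> \<chi> :: fm and p :: nat
  assumes "p \<notin> vars \<phi> \<union> vars \<psi> \<union> vars \<chi>"
    and "\<turnstile> ((\<phi> \<^bold>\<leadsto> Var p) \<^bold>\<and> (Var p \<^bold>\<leadsto> \<psi>)) \<^bold>\<longrightarrow> \<chi>"
  shows "\<turnstile> (\<phi> \<^bold>\<leadsto> \<psi>) \<^bold>\<longrightarrow> \<chi>"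
proof -
  have "\<chi> \<in> \<Gamma>" if \<Gamma>: "mcs \<Gamma>" and prem: "\<phi> \<^bold>\<leadsto> \<psi> \<in> \<Gamma>" for \<Gamma>
  proof -
    have in_worlds: "\<Gamma> \<in> worlds \<Gamma>"
      using \<Gamma> by (simp add: worlds_def)
    have global: "\<forall>u\<in>worlds \<Gamma>. \<phi> \<in> u \<longrightarrow> \<psi> \<in> u"
      using prem mcs_A4 by (auto simp: worlds_def)
    \<comment> \<open>The side conditions are \<open>\<phi> \<leadsto> \<top>\<close> and
      \<open>\<bottom> \<leadsto> \<psi>\<close>, both from (A1).\<close>
    have "sat \<Gamma> p \<phi> \<Gamma> (\<phi> \<^bold>\<leadsto> Var p)" "sat \<Gamma> p \<phi> \<Gamma> (Var p \<^bold>\<leadsto> \<psi>)"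
      using assms(1) global mcs_axioms(1,2)[OF \<Gamma>]
      by (auto simp: sat_iff_mem approx_id)
    then have "sat \<Gamma> p \<phi> \<Gamma> \<chi>"
      using MS2IC_sat[OF \<Gamma> assms(2) in_worlds, of p \<phi>] by simp
    then show ?thesis
      using assms(1) in_worlds by (simp add: sat_iff_mem)
  qed
  then show ?thesis
    by (simp add: MS2IC_iff_mcs mcs_Imp)
qed

end
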